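(* Let $(X,\mu)$ be a topological symmetric space, let $\gamma\subset X$ be a geodesic, and let $$T_\gamma:=\{s_p\circ s_q\mid p,q\in\gamma\}\subset G(X,\mu).$$ Then: (i) $T_\gamma\cong(\mathbb R,+)$ is a one-parameter subgroup of $G(X,\mu)$ (and in particular of $\mathrm{Aut}(X,\mu)$). (ii) $T_\gamma$ acts sharply transitively on $\gamma$ by Euclidean translations. (iii) If $t_1,t_2\in T_\gamma$ and $t_1|_\gamma=t_2|_\gamma$, then $t_1=t_2$. (iv) If any two points in $X$ can be connected by a finite chain of geodesic segments, then the one-parameter subgroups $T_\gamma$ (where $\gamma$ runs through all geodesics of $X$) generate a subgroup of $G(X,\mu)$ of index $\le 2$.
   Context: A topological symmetric space is a pair $(X,\mu)$ of a topological space $X$ and a continuous map $\mu:X\times X\to X$, $\mu(x,y)=x\cdot y$, such that for all $x,y,z\in X$: (RS1) $x\cdot x=x$; (RS2) $x\cdot(x\cdot y)=y$; (RS3) $x\cdot(y\cdot z)=(x\cdot y)\cdot(x\cdot z)$; (RS4) $x\cdot y=y$ implies $y=x$. $\mathrm{Aut}(X,\mu)$ is the group of homeomorphisms $\alpha$ of $X$ with $\alpha(x\cdot y)=\alpha(x)\cdot\alpha(y)$. For $x\in X$, $s_x\in\mathrm{Aut}(X,\mu)$, $s_x(y)=x\cdot y$, is the point reflection at $x$; the main group $G(X,\mu)$ is the subgroup of $\mathrm{Aut}(X,\mu)$ generated by all point reflections. A geodesic is a closed subset $\gamma\subset X$ for which there is a homeomorphism $\varphi:\mathbb R\to\gamma$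 with $\varphi(2x-y)=\mu(\varphi(x),\varphi(y))$ for all $x,y\in\mathbb R$ (a parametrization of $\gamma$). A geodesic segment is a compact connected subset of a geodesic with non-empty relative interior; a finite chain of geodesic segments connecting $p$ to $q$ is a sequence of geodesic segments, consecutive ones sharing an endpoint, leading from $p$ to $q$. "Acts by Euclidean translations" means that, transported by a parametrization $\varphi$, the action on $\gamma$ is by translations of $\mathbb R$. A one-parameter subgroup here is a subgroup isomorphic to $(\mathbb R,+)$; no topology on $G(X,\mu)$ is used.
   Formalization: The formal theorem additionally assumes that the topological space X is T0 (implied by Hausdorff or T1); without a separation axiom (i)–(iii) can fail, while under the chain hypothesis of (iv) T0 is automatic. *)

theory Defs
  imports "HOL-Analysis.Analysis" "HOL-Algebra.Algebra"
begin

text \<open>The theorem is stated over \<^class>\<open>t0_space\<close>, the weakest of the usual separation axioms.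
  Continuity determines the transvections along a geodesic from rational multiples of a given one
  only up to topological indistinguishability, so without a separation axiom the translations
  along a geodesic need not form a group.\<close>

locale topological_symmetric_space =
  fixes \<mu> :: "'a::topological_space \<Rightarrow> 'a \<Rightarrow> 'a"
  assumes continuous: "continuous_on UNIV (\<lambda>(x, y). \<mu> x y)"
    and RS1: "\<mu> x x = x"
    and RS2: "\<mu> x (\<mu> x y) = y"
    and RS3: "\<mu> x (\<mu> y z) = \<mu> (\<mu> x y) (\<mu> x z)"
    and RS4: "\<mu> x y = y \<Longrightarrow> y = x"

definition aut_group :: "('a::topological_space \<Rightarrow> 'a \<Rightarrow> 'a) \<Rightarrow> ('a \<Rightarrow> 'a) monoid" where
  "aut_group \<mu> =
    \<lparr>carrier = {\<alpha>. (\<exists>\<beta>. homeomorphism UNIV UNIV \<alpha> \<beta>) \<and>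
                    (\<forall>x y. \<alpha> (\<mu> x y) = \<mu> (\<alpha> x) (\<alpha> y))},
     monoid.mult = (\<circ>), one = id\<rparr>"

definition point_reflection :: "('a \<Rightarrow> 'a \<Rightarrow> 'a) \<Rightarrow> 'a \<Rightarrow> 'a \<Rightarrow> 'a" where
  "point_reflection \<mu> x = (\<lambda>y. \<mu> x y)"

definition main_group :: "('a::topological_space \<Rightarrow> 'a \<Rightarrow> 'a) \<Rightarrow> ('a \<Rightarrow> 'a) monoid" where
  "main_group \<mu> = (aut_group \<mu>)\<lparr>carrier := generate (aut_group \<mu>) (range (point_reflection \<mu>))\<rparr>"

definition parametrization ::
    "('a::topological_space \<Rightarrow> 'a \<Rightarrow> 'a) \<Rightarrow> 'a set \<Rightarrow> (real \<Rightarrow> 'a) \<Rightarrow> bool" where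
  "parametrization \<mu> \<gamma> \<phi> \<longleftrightarrow>
    (\<exists>\<psi>. homeomorphism UNIV \<gamma> \<phi> \<psi>) \<and> (\<forall>x y. \<phi> (2 * x - y) = \<mu> (\<phi> x) (\<phi> y))"

definition geodesic :: "('a::topological_space \<Rightarrow> 'a \<Rightarrow> 'a) \<Rightarrow> 'a set \<Rightarrow> bool" where
  "geodesic \<mu> \<gamma> \<longleftrightarrow> closed \<gamma> \<and> (\<exists>\<phi>. parametrization \<mu> \<gamma> \<phi>)"

definition geodesic_segment :: "('a::topological_space \<Rightarrow> 'a \<Rightarrow> 'a) \<Rightarrow> 'a set \<Rightarrow> bool" where
  "geodesic_segment \<mu> \<sigma> \<longleftrightarrow>
    (\<exists>\<gamma>. geodesic \<mu> \<gamma> \<and> \<sigma> \<subseteq> \<gamma> \<and> compact \<sigma> \<and> connected \<sigma> \<and>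
         (top_of_set \<gamma>) interior_of \<sigma> \<noteq> {})"

text \<open>A geodesic segment is the image of a nondegenerate compact interval under a
  parametrization; its endpoints are the images of the two ends of that interval. They do not
  depend on the geodesic and the parametrization, being the two non-cut points of the arc.\<close>

definition segment_endpoints :: "('a::topological_space \<Rightarrow> 'a \<Rightarrow> 'a) \<Rightarrow> 'a set \<Rightarrow> 'a set" where
  "segment_endpoints \<mu> \<sigma> =
    {p. \<exists>\<gamma> \<phi> a b. geodesic \<mu> \<gamma> \<and> parametrization \<mu> \<gamma> \<phi> \<and> a < b \<and> \<sigma> = \<phi> ` {a..b} \<and>
                   (p = \<phi> a \<or> p = \<phi> b)}"

text \<open>The empty chain connects each point to itself. On a space that contains a geodesic this
  does not affect whether any two points can be connected by a chain: if \<open>q \<noteq> p\<close>, a chain from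
  \<open>p\<close> to \<open>q\<close> can be run back to \<open>p\<close>.\<close>

inductive geodesic_chain ::
    "('a::topological_space \<Rightarrow> 'a \<Rightarrow> 'a) \<Rightarrow> 'a \<Rightarrow> 'a set list \<Rightarrow> 'a \<Rightarrow> bool"
  for \<mu> where
  Nil: "geodesic_chain \<mu> p [] p"
| Cons: "\<lbrakk>geodesic_segment \<mu> \<sigma>; segment_endpoints \<mu> \<sigma> = {p, r}; geodesic_chain \<mu> r \<sigma>s q\<rbrakk>
    \<Longrightarrow> geodesic_chain \<mu> p (\<sigma> # \<sigma>s) q"

definition geodesic_translations :: "('a \<Rightarrow> 'a \<Rightarrow> 'a) \<Rightarrow> 'a set \<Rightarrow> ('a \<Rightarrow> 'a) set" where
  "geodesic_translations \<mu> \<gamma> =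
    {point_reflection \<mu> p \<circ> point_reflection \<mu> q | p q. p \<in> \<gamma> \<and> q \<in> \<gamma>}"

definition real_group :: "real monoid" where
  "real_group = \<lparr>carrier = UNIV, monoid.mult = (+), one = 0\<rparr>"

definition one_parameter_subgroup :: "'g set \<Rightarrow> 'g monoid \<Rightarrow> bool" where
  "one_parameter_subgroup T G \<longleftrightarrow> subgroup T G \<and> G\<lparr>carrier := T\<rparr> \<cong> real_group"

definition sharply_transitive_on :: "('a \<Rightarrow> 'a) set \<Rightarrow> 'a set \<Rightarrow> bool" where
  "sharply_transitive_on T S \<longleftrightarrow>
    (\<forall>t\<in>T. t ` S = S) \<and> (\<forall>p\<in>S. \<forall>q\<in>S. \<exists>!t. t \<in> T \<and> t p = q)"

definition acts_by_translations ::
    "('a::topological_space \<Rightarrow> 'a \<Rightarrow> 'a) \<Rightarrow> ('a \<Rightarrow> 'a) set \<Rightarrow> 'a set \<Rightarrow> bool" where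
  "acts_by_translations \<mu> T \<gamma> \<longleftrightarrow>
    (\<forall>\<phi>. parametrization \<mu> \<gamma> \<phi> \<longrightarrow> (\<forall>t\<in>T. \<exists>c. \<forall>x. t (\<phi> x) = \<phi> (x + c)))"

text \<open>The index is the number of cosets; finiteness has to be required separately because
  \<^const>\<open>card\<close> is 0 on infinite sets.\<close>

definition subgroup_index_le_2 :: "'g set \<Rightarrow> 'g monoid \<Rightarrow> bool" where
  "subgroup_index_le_2 H G \<longleftrightarrow>
    subgroup H G \<and> finite (rcosets\<^bsub>G\<^esub> H) \<and> card (rcosets\<^bsub>G\<^esub> H) \<le> 2"

end

theory Submission
  imports Defs
begin

text \<open>
  Fix a parametrization \<open>\<phi>\<close> of a geodesic, write \<open>s(x)\<close> for the point reflection at \<open>\<phi> x\<close>, and consider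
  the transvections \<open>T(c) = s(c) \<circ> s(0)\<close>. The axioms say that the reflection at \<open>x \<cdot> y\<close> is the conjugate
  of the reflection at \<open>y\<close> by the one at \<open>x\<close>; along the geodesic this becomes the algebraic identity
  \<open>T(2x + y) = T(x) T(y) T(x)\<close>. It forces \<open>T\<close> to be additive on each cyclic group \<open>\<int>c\<close>, hence on any
  two commensurable reals. For fixed \<open>x \<noteq> 0\<close> the rational multiples of \<open>x\<close> are dense, so continuity
  of the multiplication should give \<open>T(x + y) = T(x) T(y)\<close> for all \<open>y\<close>. Limits need not be unique in a
  T0 space, but the defect of additivity is an invertible map, and applying the density argument to
  it and to its inverse shows that it moves each point only to an indistinguishable one; this is
  lemma \<open>eq_id_if_eq_id_on_dense\<close>, which yields \<open>transvection_add\<close>.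

  Additivity gives \<open>s(x) \<circ> s(y) = T(x - y)\<close>, so the products of two reflections in points of the
  geodesic are exactly the \<open>T(c)\<close>. Since \<open>T(c)\<close> takes \<open>\<phi> x\<close> to \<open>\<phi> (x + 2c)\<close>, the homomorphism \<open>T\<close> is
  injective, a translation is determined by its value at a single point of the geodesic, and the
  action on the geodesic is sharply transitive.

  If any two points are joined by a chain of geodesic segments with vertices \<open>p\<^sub>0, \<dots>, p\<^sub>n\<close>, the product
  of the reflections at \<open>p\<^sub>0\<close> and \<open>p\<^sub>n\<close> telescopes into products belonging to single geodesics. So the
  subgroup generated by all translations contains every product of two point reflections, and as
  the reflections are involutions generating the main group, there are at most two cosets: that of
  the words of even length and that of the words of odd length.
\<close>

section \<open>Continuity in spaces without limit uniqueness\<close>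

text \<open>
  In a T0 space two continuous maps that agree on a dense set may differ. Here density only gives
  that every neighbourhood of \<open>h s z\<close> contains \<open>z\<close>. The same argument for the inverse \<open>k s\<close>, transported
  by the homeomorphism \<open>h s\<close>, gives that every neighbourhood of \<open>z\<close> contains \<open>h s z\<close>, so that the two
  points are topologically indistinguishable.
\<close>

lemma eq_id_if_eq_id_on_dense:
  fixes h k :: "'s::topological_space \<Rightarrow> 'a::t0_space \<Rightarrow> 'a"
  assumes dense: "closure D = UNIV"
    and id_on_D: "\<And>s z. s \<in> D \<Longrightarrow> h s z = z"
    and hk: "\<And>s z. h s (k s z) = z"
    and kh: "\<And>s z. k s (h s z) = z"
    and cont_h: "\<And>s. continuous_on UNIV (h s)"
    and cont_h': "\<And>z. continuous_on UNIV (\<lambda>s. h s z)"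
    and cont_k': "\<And>z. continuous_on UNIV (\<lambda>s. k s z)"
  shows "h s z = z"
proof -
  have nbhd: "w \<in> U" if "open U" and "f s \<in> U" and "continuous_on UNIV f"
      and "\<And>r. r \<in> D \<Longrightarrow> f r = w" for f w U
  proof -
    have "open (f -` U)"
      using that(1,3) by (simp add: open_vimage)
    moreover have "f -` U \<inter> closure D \<noteq> {}"
      using that(2) dense by auto
    ultimately have "f -` U \<inter> D \<noteq> {}"
      by (simp add: open_Int_closure_eq_empty)
    then obtain r where "r \<in> D" "f r \<in> U"
      by auto
    then show ?thesis
      using that(4) by simp
  qed
  have k_id_on_D: "k r z = z" if "r \<in> D" for r
    using kh[of r z] id_on_D[OF that] by simp
  have "z \<in> U \<longleftrightarrow> h s z \<in> U" if "open U" for U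
  proof
    assume "z \<in> U"
    have "open (h s -` U)"
      using that cont_h by (simp add: open_vimage)
    moreover have "k s z \<in> h s -` U"
      using \<open>z \<in> U\<close> hk by simp
    ultimately have "z \<in> h s -` U"
      using nbhd[of "h s -` U" "\<lambda>s. k s z"] cont_k' k_id_on_D by blast
    then show "h s z \<in> U"
      by simp
  next
    assume "h s z \<in> U"
    then show "z \<in> U"
      using nbhd[of U "\<lambda>s. h s z"] that cont_h' id_on_D by blast
  qed
  then show ?thesis
    using t0_space_class.t0_space[of "h s z" z] by blast
qed

section \<open>The automorphism group and the main group\<close>

context topological_symmetric_space
begin

text \<open>The reflection at \<open>x \<cdot> y\<close> is the reflection at \<open>y\<close> conjugated by the one at \<open>x\<close>. As a rewrite rule
  this expresses all reflections at composite points by reflections at the given ones.\<close>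

lemma mu_left_distrib: "\<mu> (\<mu> x y) z = \<mu> x (\<mu> y (\<mu> x z))"
  by (metis RS2 RS3)

lemma continuous_on_mu [continuous_intros]:
  assumes "continuous_on S f" and "continuous_on S g"
  shows "continuous_on S (\<lambda>s. \<mu> (f s) (g s))"
  using continuous_on_compose2[OF continuous continuous_on_Pair[OF assms]] by simp

lemma group_aut_group: "group (aut_group \<mu>)"
proof (rule groupI)
  fix \<alpha> \<beta>
  assume "\<alpha> \<in> carrier (aut_group \<mu>)" "\<beta> \<in> carrier (aut_group \<mu>)"
  then show "\<alpha> \<otimes>\<^bsub>aut_group \<mu>\<^esub> \<beta> \<in> carrier (aut_group \<mu>)"
    using homeomorphism_compose by (fastforce simp: aut_group_def)
next
  show "\<one>\<^bsub>aut_group \<mu>\<^esub> \<in> carrier (aut_group \<mu>)"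
    using homeomorphism_ident[of UNIV] by (auto simp: aut_group_def id_def)
next
  fix \<alpha>
  assume "\<alpha> \<in> carrier (aut_group \<mu>)"
  then obtain \<beta> where \<beta>: "homeomorphism UNIV UNIV \<alpha> \<beta>"
    and hom: "\<And>x y. \<alpha> (\<mu> x y) = \<mu> (\<alpha> x) (\<alpha> y)"
    by (auto simp: aut_group_def)
  have inv: "\<beta> (\<alpha> x) = x" "\<alpha> (\<beta> x) = x" for x
    using \<beta> by (auto simp: homeomorphism_def)
  have "\<beta> (\<mu> x y) = \<mu> (\<beta> x) (\<beta> y)" for x y
    by (metis hom inv)
  then have "\<beta> \<in> carrier (aut_group \<mu>)"
    using homeomorphism_symD[OF \<beta>] by (auto simp: aut_group_def)
  moreover have "\<beta> \<otimes>\<^bsub>aut_group \<mu>\<^esub> \<alpha> = \<one>\<^bsub>aut_group \<mu>\<^esub>"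
    using inv by (auto simp: aut_group_def)
  ultimately show "\<exists>\<beta>\<in>carrier (aut_group \<mu>). \<beta> \<otimes>\<^bsub>aut_group \<mu>\<^esub> \<alpha> = \<one>\<^bsub>aut_group \<mu>\<^esub>"
    by blast
qed (auto simp: aut_group_def)

lemma reflection_in_aut_group: "point_reflection \<mu> x \<in> carrier (aut_group \<mu>)"
proof -
  have "homeomorphism UNIV UNIV (\<mu> x) (\<mu> x)"
    by (rule homeomorphismI) (auto simp: RS2 intro!: continuous_intros)
  then show ?thesis
    by (auto simp: aut_group_def point_reflection_def intro: RS3)
qed

lemma mult_main_group: "\<alpha> \<otimes>\<^bsub>main_group \<mu>\<^esub> \<beta> = \<alpha> \<circ> \<beta>"
  by (simp add: main_group_def aut_group_def)

lemma reflection_involution: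
  "point_reflection \<mu> x \<otimes>\<^bsub>main_group \<mu>\<^esub> point_reflection \<mu> x = \<one>\<^bsub>main_group \<mu>\<^esub>"
  by (auto simp: point_reflection_def RS2 main_group_def aut_group_def)

lemma subgroup_main_group: "subgroup (carrier (main_group \<mu>)) (aut_group \<mu>)"
  unfolding main_group_def
  using group.generate_is_subgroup[OF group_aut_group] reflection_in_aut_group
  by (auto simp: image_subset_iff)

lemma group_main_group: "group (main_group \<mu>)"
  using group.subgroup_imp_group[OF group_aut_group subgroup_main_group]
  by (simp add: main_group_def)

lemma reflection_in_main_group: "point_reflection \<mu> x \<in> carrier (main_group \<mu>)"
  by (auto simp: main_group_def intro: generate.incl)

lemma generate_main_group:
  "generate (main_group \<mu>) (range (point_reflection \<mu>)) = carrier (main_group \<mu>)"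
  using group.generate_consistent[OF group_aut_group _ subgroup_main_group,
      of "range (point_reflection \<mu>)"] reflection_in_main_group
  by (auto simp: main_group_def)

lemma geodesic_translations_subset_main_group:
  "geodesic_translations \<mu> \<gamma> \<subseteq> carrier (main_group \<mu>)"
proof -
  interpret G: group "main_group \<mu>"
    by (rule group_main_group)
  show ?thesis
    unfolding geodesic_translations_def mult_main_group[symmetric]
    using G.m_closed[OF reflection_in_main_group reflection_in_main_group] by auto
qed

end

section \<open>Transvections along a parametrized geodesic\<close>

text \<open>The identities for transvections use only that \<open>\<phi>\<close> is a continuous morphism from the symmetric
  space \<open>\<real>\<close>, with \<open>x \<cdot> y = 2x - y\<close>. Separation of points and injectivity of \<open>\<phi>\<close> are added in the two
  locales that extend this one.\<close>

locale symmetric_space_curve = topological_symmetric_space \<mu>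
  for \<mu> :: "'a::topological_space \<Rightarrow> 'a \<Rightarrow> 'a" +
  fixes \<phi> :: "real \<Rightarrow> 'a"
  assumes cont_phi: "continuous_on UNIV \<phi>"
    and phi_reflect: "\<phi> (2 * x - y) = \<mu> (\<phi> x) (\<phi> y)"
begin

definition transvection :: "real \<Rightarrow> 'a \<Rightarrow> 'a" where
  "transvection c z = \<mu> (\<phi> c) (\<mu> (\<phi> 0) z)"

lemma continuous_on_transvection [continuous_intros]:
  assumes "continuous_on S f" and "continuous_on S g"
  shows "continuous_on S (\<lambda>s. transvection (f s) (g s))"
  unfolding transvection_def
  by (intro continuous_intros assms continuous_on_compose2[OF cont_phi]) auto

lemma transvection_0: "transvection 0 z = z"
  by (simp add: transvection_def RS2)

lemma phi_uminus: "\<phi> (- x) = \<mu> (\<phi> 0) (\<phi> x)"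
  using phi_reflect[of 0 x] by simp

lemma transvection_uminus: "transvection (- c) z = \<mu> (\<phi> 0) (\<mu> (\<phi> c) z)"
  by (simp add: transvection_def phi_uminus mu_left_distrib RS2)

lemma transvection_inverse:
  "transvection (- c) (transvection c z) = z" "transvection c (transvection (- c) z) = z"
  by (simp_all add: transvection_uminus) (simp_all add: transvection_def RS2)

lemma transvection_cancel: "transvection c y = transvection c z \<longleftrightarrow> y = z"
  by (metis transvection_inverse(1))

text \<open>The identity from which additivity is derived: a transvection is \<open>T(c) = s(c) s(0)\<close>, and
  \<open>2x + y\<close> is the reflection of \<open>-y\<close> at \<open>x\<close>, hence \<open>T(2x + y) = s(x) s(0) s(y) s(0) s(x) s(0)\<close>.\<close>

lemma transvection_twice_plus:
  "transvection (2 * x + y) z = transvection x (transvection y (transvection x z))"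
proof -
  have "\<phi> (2 * x + y) = \<mu> (\<phi> x) (\<mu> (\<phi> 0) (\<phi> y))"
    using phi_reflect[of x "- y"] by (simp add: phi_uminus)
  then show ?thesis
    by (simp add: transvection_def mu_left_distrib)
qed

lemma transvection_phi: "transvection c (\<phi> x) = \<phi> (x + 2 * c)"
  using phi_reflect[of c "- x"] by (simp add: transvection_def phi_uminus add.commute)

text \<open>Both orders of composition are carried along: in either direction the induction step compares
  \<open>T(2c + nc) = T(c) T(nc) T(c)\<close> with the hypothesis, which absorbs one of the two outer factors on
  the left and the other one on the right.\<close>

lemma transvection_int_step:
  fixes n :: int and c :: real
  shows "(\<forall>z. transvection (c + n * c) z = transvection c (transvection (n * c) z)) \<and>
         (\<forall>z. transvection (c + n * c) z = transvection (n * c) (transvection c z))"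
proof (induction n rule: int_induct[where k = 0])
  case base
  show ?case
    by (simp add: transvection_0)
next
  case (step1 n)
  have "c + (n + 1) * c = 2 * c + n * c" "(n + 1) * c = c + n * c"
    by (simp_all add: algebra_simps)
  then show ?case
    using step1.IH transvection_twice_plus[of c "n * c"] by (metis of_int_1 of_int_add)
next
  case (step2 n)
  have eqs: "c + real_of_int (n - 1) * c = n * c" "c + n * c = 2 * c + real_of_int (n - 1) * c"
    by (simp_all add: algebra_simps)
  have "transvection (2 * c + real_of_int (n - 1) * c) z = transvection c (transvection (n * c) z)"
       "transvection (2 * c + real_of_int (n - 1) * c) z = transvection (n * c) (transvection c z)" for z
    using step2.IH eqs(2) by metis+
  note * = this[unfolded transvection_twice_plus]
  show ?case
    unfolding eqs(1)
  proof (intro conjI allI)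
    fix z
    show "transvection (n * c) z = transvection (real_of_int (n - 1) * c) (transvection c z)"
      using *(1) transvection_cancel by metis
    show "transvection (n * c) z = transvection c (transvection (real_of_int (n - 1) * c) z)"
      using *(2)[of "transvection (- c) z"] by (simp add: transvection_inverse)
  qed
qed

lemma transvection_int_add:
  fixes m n :: int and c :: real
  shows "transvection (m * c + n * c) z = transvection (m * c) (transvection (n * c) z)"
proof (induction m arbitrary: z rule: int_induct[where k = 0])
  case base
  show ?case
    by (simp add: transvection_0)
next
  case (step1 m)
  have eqs: "real_of_int (m + 1) * c + n * c = c + real_of_int (m + n) * c"
    "real_of_int (m + 1) * c = c + m * c" "real_of_int (m + n) * c = m * c + n * c"
    by (simp_all add: algebra_simps)
  have "transvection (real_of_int (m + 1) * c + n * c) z =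
      transvection c (transvection (real_of_int (m + n) * c) z)"
    unfolding eqs(1) using transvection_int_step[of c "m + n"] by blast
  also have "\<dots> = transvection c (transvection (m * c) (transvection (n * c) z))"
    unfolding eqs(3) step1.IH ..
  also have "\<dots> = transvection (real_of_int (m + 1) * c) (transvection (n * c) z)"
    unfolding eqs(2) using transvection_int_step[of c m] by simp
  finally show ?case .
next
  case (step2 m)
  have eqs: "m * c + n * c = c + real_of_int (m - 1 + n) * c"
    "m * c = c + real_of_int (m - 1) * c"
    "real_of_int (m - 1) * c + n * c = real_of_int (m - 1 + n) * c"
    by (simp_all add: algebra_simps)
  have "transvection c (transvection (real_of_int (m - 1 + n) * c) z) =
      transvection (m * c + n * c) z"
    unfolding eqs(1) using transvection_int_step[of c "m - 1 + n"] by simp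
  also have "\<dots> = transvection (m * c) (transvection (n * c) z)"
    by (rule step2.IH)
  also have "\<dots> = transvection c (transvection (real_of_int (m - 1) * c) (transvection (n * c) z))"
    unfolding eqs(2) using transvection_int_step[of c "m - 1"] by blast
  finally show ?case
    unfolding eqs(3) transvection_cancel .
qed

text \<open>If \<open>r = m / n\<close>, then \<open>x\<close> and \<open>r x\<close> are both integer multiples of \<open>x / n\<close>.\<close>

lemma transvection_rat_add:
  assumes "r \<in> \<rat>"
  shows "transvection (x + r * x) z = transvection x (transvection (r * x) z)"
proof -
  obtain m n :: int where "n > 0" and r: "r = m / n"
    by (rule Rats_cases'[OF assms])
  then have "n * (x / n) = x" "m * (x / n) = r * x"
    by simp_all
  then show ?thesis
    using transvection_int_add[of n "x / n" m z] by (simp only:)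
qed

end

locale t0_symmetric_space_curve = symmetric_space_curve \<mu> \<phi>
  for \<mu> :: "'a::t0_space \<Rightarrow> 'a \<Rightarrow> 'a" and \<phi>
begin

lemma transvection_add: "transvection (x + y) z = transvection x (transvection y z)"
proof (cases "x = 0")
  case True
  then show ?thesis
    by (simp add: transvection_0)
next
  case False
  \<comment> \<open>The defect of additivity at \<open>(x, s x)\<close> and its inverse; the parameter \<open>s\<close> makes the pairs where
    additivity is known correspond to the rational numbers.\<close>
  define h where "h s z = transvection (- (x + s * x)) (transvection x (transvection (s * x) z))" for s z
  define k where "k s z = transvection (- (s * x)) (transvection (- x) (transvection (x + s * x) z))" for s z
  have "h (y / x) z = z"
  proof (rule eq_id_if_eq_id_on_dense[where D = \<rat> and k = k])
    show "closure \<rat> = (UNIV :: real set)"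
      by (rule Rats_closure_real)
    show "h s z = z" if "s \<in> \<rat>" for s z
      unfolding h_def transvection_rat_add[OF that, symmetric] by (rule transvection_inverse)
    show "h s (k s z) = z" "k s (h s z) = z" for s z
      unfolding h_def k_def by (simp_all only: transvection_inverse)
    show "continuous_on UNIV (h s)" "continuous_on UNIV (\<lambda>s. h s z)"
      "continuous_on UNIV (\<lambda>s. k s z)" for s z
      unfolding h_def k_def by (intro continuous_intros)+
  qed
  moreover have "y / x * x = y"
    using False by simp
  ultimately have "transvection (- (x + y)) (transvection x (transvection y z)) = z"
    unfolding h_def by (simp only:)
  from arg_cong[OF this, of "transvection (x + y)"] show ?thesis
    unfolding transvection_inverse(2) by (rule sym)
qed

lemma reflection_compose_reflection: "\<mu> (\<phi> x) (\<mu> (\<phi> y) z) = transvection (x - y) z"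
proof -
  have "transvection (x - y) z = transvection x (transvection (- y) z)"
    using transvection_add[of x "- y" z] by simp
  then show ?thesis
    unfolding transvection_uminus by (simp add: transvection_def RS2)
qed

lemma geodesic_translations_eq_range:
  "geodesic_translations \<mu> (range \<phi>) = range transvection"
proof -
  have *: "point_reflection \<mu> (\<phi> x) \<circ> point_reflection \<mu> (\<phi> y) = transvection (x - y)" for x y
    by (auto simp: point_reflection_def reflection_compose_reflection)
  have "transvection c \<in> geodesic_translations \<mu> (range \<phi>)" for c
    unfolding geodesic_translations_def
    by (rule CollectI, rule exI[of _ "\<phi> c"], rule exI[of _ "\<phi> 0"]) (simp add: *)
  then show ?thesis
    using * by (auto simp: geodesic_translations_def)
qed

end

locale geodesic_curve = t0_symmetric_space_curve +
  assumes inj_phi: "inj \<phi>"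
begin

lemma inj_transvection: "inj transvection"
proof (rule injI)
  fix x y
  assume "transvection x = transvection y"
  then have "\<phi> (0 + 2 * x) = \<phi> (0 + 2 * y)"
    using transvection_phi by metis
  then show "x = y"
    using inj_phi by (simp add: inj_eq)
qed

lemma one_parameter_subgroup_aut_group:
  "one_parameter_subgroup (range transvection) (aut_group \<mu>)"
proof -
  interpret A: group "aut_group \<mu>"
    by (rule group_aut_group)
  have group_real: "group real_group"
    unfolding real_group_def by (rule groupI) (auto intro: exI[of _ "- _"])
  have in_aut: "range transvection \<subseteq> carrier (aut_group \<mu>)"
    using geodesic_translations_subset_main_group subgroup.subset[OF subgroup_main_group]
    unfolding geodesic_translations_eq_range[symmetric] by blast
  have hom: "transvection \<in> hom real_group (aut_group \<mu>)"
    using in_aut by (auto simp: hom_def real_group_def aut_group_def transvection_add)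
  then interpret group_hom real_group "aut_group \<mu>" transvection
    using group_real by (simp add: group_hom_def group_hom_axioms_def A.group_axioms)
  have "subgroup (range transvection) (aut_group \<mu>)"
    using img_is_subgroup by (simp add: real_group_def)
  moreover have "transvection \<in> iso real_group (aut_group \<mu>\<lparr>carrier := range transvection\<rparr>)"
    using hom inj_transvection
    by (auto simp: iso_def hom_def bij_betw_def real_group_def)
  ultimately show ?thesis
    using group.iso_sym[OF group_real] by (auto simp: one_parameter_subgroup_def is_iso_def)
qed

lemma one_parameter_subgroup_main_group:
  "one_parameter_subgroup (range transvection) (main_group \<mu>)"
proof -
  have "subgroup (range transvection) (main_group \<mu>)"
    using group.subgroup_incl[OF group_aut_group _ subgroup_main_group, of "range transvection"]
      one_parameter_subgroup_aut_group geodesic_translations_subset_main_group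
    unfolding geodesic_translations_eq_range[symmetric]
    by (simp add: main_group_def one_parameter_subgroup_def)
  then show ?thesis
    using one_parameter_subgroup_aut_group
    by (simp add: main_group_def one_parameter_subgroup_def)
qed

lemma transvection_eq_if_eq_at_point:
  assumes "transvection a (\<phi> x) = transvection b (\<phi> x)"
  shows "a = b"
  using assms inj_phi by (simp add: transvection_phi inj_eq)

lemma sharply_transitive_on_range: "sharply_transitive_on (range transvection) (range \<phi>)"
  unfolding sharply_transitive_on_def
proof (intro conjI ballI)
  fix t
  assume "t \<in> range transvection"
  then obtain c where t: "t = transvection c"
    by blast
  have "\<phi> x = t (\<phi> (x - 2 * c))" for x
    by (simp add: t transvection_phi)
  then have "\<phi> x \<in> t ` range \<phi>" for x
    by (metis imageI rangeI)
  then show "t ` range \<phi> = range \<phi>"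
    by (auto simp: t transvection_phi)
next
  fix p q
  assume "p \<in> range \<phi>" "q \<in> range \<phi>"
  then obtain x y where "p = \<phi> x" "q = \<phi> y"
    by blast
  then have "transvection ((y - x) / 2) p = q"
    by (simp add: transvection_phi field_simps)
  then show "\<exists>!t. t \<in> range transvection \<and> t p = q"
    using transvection_eq_if_eq_at_point \<open>p = \<phi> x\<close> by blast
qed

end

lemma geodesic_curve_parametrization:
  fixes \<mu> :: "'a::t0_space \<Rightarrow> 'a \<Rightarrow> 'a"
  assumes "topological_symmetric_space \<mu>" and "parametrization \<mu> \<gamma> \<phi>"
  shows "geodesic_curve \<mu> \<phi>" and "\<gamma> = range \<phi>"
proof -
  interpret topological_symmetric_space \<mu>
    by fact
  obtain \<psi> where \<psi>: "homeomorphism UNIV \<gamma> \<phi> \<psi>"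
    and reflect: "\<And>x y. \<phi> (2 * x - y) = \<mu> (\<phi> x) (\<phi> y)"
    using assms(2) by (auto simp: parametrization_def)
  show "\<gamma> = range \<phi>"
    using \<psi> by (simp add: homeomorphism_def)
  have "inj \<phi>" "continuous_on UNIV \<phi>"
    using \<psi> by (auto simp: homeomorphism_def intro: inj_on_inverseI)
  then show "geodesic_curve \<mu> \<phi>"
    by unfold_locales (auto simp: reflect)
qed

section \<open>Groups generated by involutions\<close>

text \<open>
  An element is called even if it and its conjugate by \<open>s\<close> lie in \<open>H\<close>, and odd if its products with \<open>s\<close>
  on both sides lie in \<open>H\<close>. Generators are odd, and these two kinds multiply like the parities of word
  lengths. The conditions are two-sided because normality of \<open>H\<close> is not known beforehand: moving a
  factor past \<open>s\<close> has to stay inside \<open>H\<close>.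
\<close>

lemma subgroup_index_le_2_if_products_of_involutions:
  fixes G :: "'g monoid" (structure)
  assumes group: "group G"
    and gen: "generate G R = carrier G"
    and R: "R \<subseteq> carrier G" "s \<in> R"
    and involution: "\<And>r. r \<in> R \<Longrightarrow> r \<otimes> r = \<one>"
    and H: "subgroup H G"
    and products: "\<And>r r'. r \<in> R \<Longrightarrow> r' \<in> R \<Longrightarrow> r \<otimes> r' \<in> H"
  shows "subgroup_index_le_2 H G"
proof -
  interpret group G
    by (rule group)
  interpret H: subgroup H G
    by (rule H)
  have s: "s \<in> carrier G" "s \<otimes> s = \<one>"
    using R involution by auto
  have ss: "s \<otimes> (s \<otimes> g) = g" if "g \<in> carrier G" for g
    using that s by (simp add: m_assoc[symmetric])
  define is_even where "is_even g \<longleftrightarrow> g \<in> H \<and> s \<otimes> g \<otimes> s \<in> H" for g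
  define is_odd where "is_odd g \<longleftrightarrow> g \<otimes> s \<in> H \<and> s \<otimes> g \<in> H" for g
  have mult: "is_even g \<Longrightarrow> is_even h \<Longrightarrow> is_even (g \<otimes> h)"
      "is_even g \<Longrightarrow> is_odd h \<Longrightarrow> is_odd (g \<otimes> h)"
      "is_odd g \<Longrightarrow> is_even h \<Longrightarrow> is_odd (g \<otimes> h)"
      "is_odd g \<Longrightarrow> is_odd h \<Longrightarrow> is_even (g \<otimes> h)"
    if "g \<in> carrier G" "h \<in> carrier G" for g h
  proof -
    have left_even: "s \<otimes> (g \<otimes> h) \<otimes> s = (s \<otimes> g \<otimes> s) \<otimes> (s \<otimes> h \<otimes> s)"
        "(g \<otimes> h) \<otimes> s = g \<otimes> (h \<otimes> s)" "s \<otimes> (g \<otimes> h) = (s \<otimes> g \<otimes> s) \<otimes> (s \<otimes> h)"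
      using that s by (simp_all add: m_assoc ss)
    have left_odd: "(g \<otimes> h) \<otimes> s = (g \<otimes> s) \<otimes> (s \<otimes> h \<otimes> s)" "s \<otimes> (g \<otimes> h) = (s \<otimes> g) \<otimes> h"
        "g \<otimes> h = (g \<otimes> s) \<otimes> (s \<otimes> h)" "s \<otimes> (g \<otimes> h) \<otimes> s = (s \<otimes> g) \<otimes> (h \<otimes> s)"
      using that s by (simp_all add: m_assoc ss)
    show "is_even (g \<otimes> h)" if "is_even g" "is_even h"
      using that H.m_closed unfolding is_even_def left_even(1) by blast
    show "is_odd (g \<otimes> h)" if "is_even g" "is_odd h"
      using that H.m_closed unfolding is_even_def is_odd_def left_even(2,3) by blast
    show "is_odd (g \<otimes> h)" if "is_odd g" "is_even h"
      using that H.m_closed unfolding is_even_def is_odd_def left_odd(1,2) by blast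
    have "g \<otimes> h \<in> H" if "is_odd g" "is_odd h"
      using that H.m_closed unfolding is_odd_def left_odd(3) by blast
    moreover have "s \<otimes> (g \<otimes> h) \<otimes> s \<in> H" if "is_odd g" "is_odd h"
      using that H.m_closed unfolding is_odd_def left_odd(4) by blast
    ultimately show "is_even (g \<otimes> h)" if "is_odd g" "is_odd h"
      using that by (simp add: is_even_def)
  qed
  have is_odd_R: "is_odd r" if "r \<in> R" for r
    using that products R by (auto simp: is_odd_def)
  have "is_even g \<or> is_odd g" if "g \<in> generate G R" for g
    using that
  proof induction
    case one
    show ?case
      using s by (simp add: is_even_def)
  next
    case (incl r)
    then show ?case
      by (simp add: is_odd_R)
  next
    case (inv r)
    then have "inv r = r"
      using R involution by (intro inv_equality) auto
    then show ?case
      using inv by (simp add: is_odd_R)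
  next
    case (eng g h)
    then have "g \<in> carrier G" "h \<in> carrier G"
      using gen by auto
    from mult[OF this] eng.IH show ?case
      by blast
  qed
  then have cover: "g \<in> H \<or> g \<otimes> s \<in> H" if "g \<in> carrier G" for g
    using that gen by (auto simp: is_even_def is_odd_def)
  have "H #> g \<in> {H, H #> s}" if g: "g \<in> carrier G" for g
  proof (cases "g \<in> H")
    case True
    then show ?thesis
      using coset_join2[OF g H] by simp
  next
    case False
    then have "g \<otimes> s \<in> H"
      using cover[OF g] by simp
    moreover have "g = (g \<otimes> s) \<otimes> s"
      using g s by (simp add: m_assoc)
    ultimately have "g \<in> H #> s"
      by (auto simp: r_coset_def)
    then show ?thesis
      using repr_independence[OF _ s(1) H] by blast
  qed
  then have sub: "rcosets H \<subseteq> {H, H #> s}"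
    by (auto simp: RCOSETS_def)
  then have "finite (rcosets H)"
    by (rule finite_subset) simp
  moreover have "card (rcosets H) \<le> card {H, H #> s}"
    using sub by (intro card_mono) auto
  moreover have "card {H, H #> s} \<le> 2"
    by (simp add: card_insert_if)
  ultimately show ?thesis
    using H by (simp add: subgroup_index_le_2_def)
qed

section \<open>Chains of geodesic segments\<close>

text \<open>The two endpoints may be witnessed by different geodesics and parametrizations, but both lie in
  the segment, which is contained in any of these geodesics.\<close>

lemma segment_endpoints_on_common_geodesic:
  assumes "segment_endpoints \<mu> \<sigma> = {p, r}"
  obtains \<gamma> where "geodesic \<mu> \<gamma>" "p \<in> \<gamma>" "r \<in> \<gamma>"
proof -
  have p: "p \<in> segment_endpoints \<mu> \<sigma>" and r: "r \<in> segment_endpoints \<mu> \<sigma>"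
    using assms by auto
  have "p \<in> \<sigma>" "r \<in> \<sigma>"
    using p r by (auto simp: segment_endpoints_def)
  moreover obtain \<gamma> \<phi> a b where "geodesic \<mu> \<gamma>" "parametrization \<mu> \<gamma> \<phi>" "\<sigma> = \<phi> ` {a..b::real}"
    using p by (auto simp: segment_endpoints_def)
  moreover from this have "\<sigma> \<subseteq> \<gamma>"
    by (auto simp: parametrization_def homeomorphism_def)
  ultimately show thesis
    using that by blast
qed

text \<open>The product telescopes along the chain, since each reflection is its own inverse.\<close>

lemma (in topological_symmetric_space) chain_reflections_in_subgroup:
  assumes "geodesic_chain \<mu> p \<sigma>s q"
    and H: "subgroup H (main_group \<mu>)"
    and translations_in_H: "\<And>\<gamma>. geodesic \<mu> \<gamma> \<Longrightarrow> geodesic_translations \<mu> \<gamma> \<subseteq> H"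
  shows "point_reflection \<mu> p \<circ> point_reflection \<mu> q \<in> H"
  using assms(1)
proof induction
  case (Nil p)
  show ?case
    using subgroup.one_closed[OF H]
    unfolding mult_main_group[symmetric] reflection_involution .
next
  case (Cons \<sigma> p r \<sigma>s q)
  obtain \<gamma> where "geodesic \<mu> \<gamma>" "p \<in> \<gamma>" "r \<in> \<gamma>"
    using segment_endpoints_on_common_geodesic[OF Cons.hyps(2)] .
  then have "point_reflection \<mu> p \<circ> point_reflection \<mu> r \<in> H"
    using translations_in_H by (force simp: geodesic_translations_def)
  then have "(point_reflection \<mu> p \<circ> point_reflection \<mu> r) \<circ>
      (point_reflection \<mu> r \<circ> point_reflection \<mu> q) \<in> H"
    using subgroup.m_closed[OF H _ Cons.IH] by (simp only: mult_main_group)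
  moreover have "(point_reflection \<mu> p \<circ> point_reflection \<mu> r) \<circ>
      (point_reflection \<mu> r \<circ> point_reflection \<mu> q) = point_reflection \<mu> p \<circ> point_reflection \<mu> q"
    by (auto simp: point_reflection_def RS2)
  ultimately show ?case
    by (simp only:)
qed

lemma (in topological_symmetric_space) translations_generate_index_le_2:
  assumes "\<forall>p q. \<exists>\<sigma>s. geodesic_chain \<mu> p \<sigma>s q"
  shows "subgroup_index_le_2
    (generate (main_group \<mu>) (\<Union>\<gamma> \<in> {\<gamma>. geodesic \<mu> \<gamma>}. geodesic_translations \<mu> \<gamma>))
    (main_group \<mu>)" (is "subgroup_index_le_2 ?H _")
proof -
  interpret G: group "main_group \<mu>"
    by (rule group_main_group)
  have H: "subgroup ?H (main_group \<mu>)"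
    using geodesic_translations_subset_main_group by (intro G.generate_is_subgroup) blast
  have products: "point_reflection \<mu> p \<circ> point_reflection \<mu> q \<in> ?H" for p q
  proof -
    obtain \<sigma>s where "geodesic_chain \<mu> p \<sigma>s q"
      using assms by blast
    then show ?thesis
      by (rule chain_reflections_in_subgroup[OF _ H]) (auto intro: generate.incl)
  qed
  show ?thesis
  proof (rule subgroup_index_le_2_if_products_of_involutions[OF group_main_group generate_main_group])
    show "range (point_reflection \<mu>) \<subseteq> carrier (main_group \<mu>)"
      using reflection_in_main_group by blast
    show "point_reflection \<mu> undefined \<in> range (point_reflection \<mu>)"
      by simp
    show "r \<otimes>\<^bsub>main_group \<mu>\<^esub> r = \<one>\<^bsub>main_group \<mu>\<^esub>"
      if "r \<in> range (point_reflection \<mu>)" for r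
      using that reflection_involution by blast
    show "r \<otimes>\<^bsub>main_group \<mu>\<^esub> r' \<in> ?H"
      if "r \<in> range (point_reflection \<mu>)" "r' \<in> range (point_reflection \<mu>)" for r r'
      using that products unfolding mult_main_group by blast
  qed (rule H)
qed

theorem theorem1p3:
  fixes \<mu> :: "'a::t0_space \<Rightarrow> 'a \<Rightarrow> 'a" and \<gamma> :: "'a set"
  assumes "topological_symmetric_space \<mu>"
    and "geodesic \<mu> \<gamma>"
  shows
    "(one_parameter_subgroup (geodesic_translations \<mu> \<gamma>) (main_group \<mu>) \<and>
      one_parameter_subgroup (geodesic_translations \<mu> \<gamma>) (aut_group \<mu>)) \<and>
     (sharply_transitive_on (geodesic_translations \<mu> \<gamma>) \<gamma> \<and>
      acts_by_translations \<mu> (geodesic_translations \<mu> \<gamma>) \<gamma>) \<and>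
     (\<forall>t1 \<in> geodesic_translations \<mu> \<gamma>. \<forall>t2 \<in> geodesic_translations \<mu> \<gamma>.
        (\<forall>x\<in>\<gamma>. t1 x = t2 x) \<longrightarrow> t1 = t2) \<and>
     ((\<forall>p q. \<exists>\<sigma>s. geodesic_chain \<mu> p \<sigma>s q) \<longrightarrow>
      subgroup_index_le_2
        (generate (main_group \<mu>) (\<Union>\<gamma>' \<in> {\<gamma>'. geodesic \<mu> \<gamma>'}. geodesic_translations \<mu> \<gamma>'))
        (main_group \<mu>))"
proof -
  obtain \<phi> where \<phi>: "parametrization \<mu> \<gamma> \<phi>"
    using assms(2) by (auto simp: geodesic_def)
  interpret geodesic_curve \<mu> \<phi>
    by (rule geodesic_curve_parametrization(1)[OF assms(1) \<phi>])
  have \<gamma>: "\<gamma> = range \<phi>"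
    by (rule geodesic_curve_parametrization(2)[OF assms(1) \<phi>])
  have T: "geodesic_translations \<mu> \<gamma> = range transvection"
    unfolding \<gamma> by (rule geodesic_translations_eq_range)
  have "acts_by_translations \<mu> (geodesic_translations \<mu> \<gamma>) \<gamma>"
    unfolding acts_by_translations_def
  proof (intro allI impI ballI)
    fix \<phi>' t
    assume \<phi>': "parametrization \<mu> \<gamma> \<phi>'" and t: "t \<in> geodesic_translations \<mu> \<gamma>"
    \<comment> \<open>The set of translations does not refer to a parametrization, so every parametrization
      presents its elements as transvections along itself.\<close>
    interpret other: geodesic_curve \<mu> \<phi>'
      by (rule geodesic_curve_parametrization(1)[OF assms(1) \<phi>'])
    have "t \<in> range other.transvection"
      using t other.geodesic_translations_eq_range
        geodesic_curve_parametrization(2)[OF assms(1) \<phi>'] by simp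
    then show "\<exists>c. \<forall>x. t (\<phi>' x) = \<phi>' (x + c)"
      by (auto simp: other.transvection_phi)
  qed
  moreover have "\<forall>t1 \<in> geodesic_translations \<mu> \<gamma>. \<forall>t2 \<in> geodesic_translations \<mu> \<gamma>.
      (\<forall>x\<in>\<gamma>. t1 x = t2 x) \<longrightarrow> t1 = t2"
    unfolding T unfolding \<gamma> using transvection_eq_if_eq_at_point by blast
  ultimately show ?thesis
    using one_parameter_subgroup_aut_group one_parameter_subgroup_main_group
      sharply_transitive_on_range translations_generate_index_le_2
    unfolding T unfolding \<gamma> by blast
qed

end
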